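(* Let $H$ be a separable Hilbert space, let $K$ be a bounded linear operator on $H$ with closed range, let $C\in GL^+(H)$ satisfy $CK=KC$, and let $\{f_n\}_{n=1}^\infty\subset H$ be a $C$-controlled $K$-frame for $H$. Then $\{f_n\}_{n=1}^\infty$ is a $K$-frame for $H$.
   Context: $GL^+(H)$ is the set of positive bounded linear operators on $H$ having a bounded inverse, where $T$ is positive if it is self-adjoint and $\langle Tf,f\rangle>0$ for all $f\neq0$; $C^{1/2}$ is the unique non-negative square root of $C$. A sequence $\{f_n\}_{n=1}^\infty\subset H$ is a $K$-frame for $H$ if there exist constants $A,B>0$ such that $A\|K^*f\|^2\le\sum_{n=1}^\infty|\langle f,f_n\rangle|^2\le B\|f\|^2$ for all $f\in H$; if only the right-hand inequality is required, it is a $K$-Bessel sequence. Given $C\in GL^+(H)$ with $CK=KC$, the sequence $\{f_n\}_{n=1}^\infty$ is a $C$-controlled $K$-frame for $H$ if it is a $K$-Bessel sequence and there exist constants $A>0$ and $B<\infty$ such that $A\|C^{1/2}K^*f\|^2\le\sum_{n=1}^\infty\langle f,f_n\rangle\langle Cf_n,f\rangle\le B\|f\|^2$ for all $f\in H$ (in particular the middle sum is real). *)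

theory Defs
  imports "HOL-Analysis.Analysis"
begin

text \<open>
  The scalar field is a type of class \<open>rclike\<close>, so that real and complex Hilbert spaces are treated
  at once: \<open>real\<close> and \<open>complex\<close> are the intended instances.
\<close>

class rclike = real_normed_field +
  fixes conj :: "'a \<Rightarrow> 'a"
  assumes conj_add: "conj (a + b) = conj a + conj b"
    and conj_mult: "conj (a * b) = conj a * conj b"
    and conj_conj: "conj (conj a) = a"
    and mult_conj: "a * conj a = scaleR ((norm a)\<^sup>2) 1"

instantiation real :: rclike
begin
definition conj_real :: "real \<Rightarrow> real" where "conj_real a = a"
instance by standard (auto simp: conj_real_def power2_eq_square)
end

instantiation complex :: rclike
begin
definition conj_complex :: "complex \<Rightarrow> complex" where "conj_complex = cnj"
instance by standard (auto simp: conj_complex_def complex_norm_square[symmetric] scaleR_conv_of_real)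
end

text \<open>
  Completeness is part of the class \<open>banach\<close>; the last two assumptions tie the norm and the real
  scalar multiplication of that class to the inner product and to \<open>smul\<close>.
  Inner products are linear in the first argument.
\<close>

locale hilbert_space = vector_space smul
  for smul :: "'k::rclike \<Rightarrow> 'h::banach \<Rightarrow> 'h" +
  fixes ip :: "'h \<Rightarrow> 'h \<Rightarrow> 'k"
  assumes ip_add_left: "ip (x + y) z = ip x z + ip y z"
    and ip_smul_left: "ip (smul a x) y = a * ip x y"
    and ip_commute: "ip y x = conj (ip x y)"
    and ip_self: "ip x x = of_real ((norm x)\<^sup>2)"
    and smul_of_real: "smul (of_real r) x = r *\<^sub>R x"

lemma hilbert_space_real:
  "hilbert_space (scaleR :: real \<Rightarrow> 'h::{real_inner, banach} \<Rightarrow> 'h) inner"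
  by unfold_locales
    (auto simp: inner_add_left inner_add_right inner_commute conj_real_def power2_norm_eq_inner scaleR_add_right
      scaleR_add_left)

lemma hilbert_space_complex:
  "hilbert_space ((*) :: complex \<Rightarrow> complex \<Rightarrow> complex) (\<lambda>x y. x * cnj y)"
  by unfold_locales
    (auto simp: conj_complex_def complex_norm_square[symmetric] algebra_simps scaleR_conv_of_real)

definition bounded_op :: "('k::rclike \<Rightarrow> 'h::banach \<Rightarrow> 'h) \<Rightarrow> ('h \<Rightarrow> 'h) \<Rightarrow> bool" where
  "bounded_op smul T \<longleftrightarrow>
     Vector_Spaces.linear smul smul T \<and> (\<exists>M. \<forall>x. norm (T x) \<le> M * norm x)"

definition adj :: "('h::banach \<Rightarrow> 'h \<Rightarrow> 'k::rclike) \<Rightarrow> ('h \<Rightarrow> 'h) \<Rightarrow> 'h \<Rightarrow> 'h" where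
  "adj ip T = (THE S. \<forall>x y. ip (T x) y = ip x (S y))"

definition self_adjoint ::
  "('k::rclike \<Rightarrow> 'h::banach \<Rightarrow> 'h) \<Rightarrow> ('h \<Rightarrow> 'h \<Rightarrow> 'k) \<Rightarrow> ('h \<Rightarrow> 'h) \<Rightarrow> bool" where
  "self_adjoint smul ip T \<longleftrightarrow> bounded_op smul T \<and> adj ip T = T"

definition positive_op ::
  "('k::rclike \<Rightarrow> 'h::banach \<Rightarrow> 'h) \<Rightarrow> ('h \<Rightarrow> 'h \<Rightarrow> 'k) \<Rightarrow> ('h \<Rightarrow> 'h) \<Rightarrow> bool" where
  "positive_op smul ip T \<longleftrightarrow>
     self_adjoint smul ip T \<and> (\<forall>x. x \<noteq> 0 \<longrightarrow> (\<exists>r>0. ip (T x) x = of_real r))"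

definition nonneg_op ::
  "('k::rclike \<Rightarrow> 'h::banach \<Rightarrow> 'h) \<Rightarrow> ('h \<Rightarrow> 'h \<Rightarrow> 'k) \<Rightarrow> ('h \<Rightarrow> 'h) \<Rightarrow> bool" where
  "nonneg_op smul ip T \<longleftrightarrow>
     self_adjoint smul ip T \<and> (\<forall>x. \<exists>r\<ge>0. ip (T x) x = of_real r)"

definition GL_plus ::
  "('k::rclike \<Rightarrow> 'h::banach \<Rightarrow> 'h) \<Rightarrow> ('h \<Rightarrow> 'h \<Rightarrow> 'k) \<Rightarrow> ('h \<Rightarrow> 'h) set" where
  "GL_plus smul ip =
     {T. positive_op smul ip T \<and> (\<exists>S. bounded_op smul S \<and> S \<circ> T = id \<and> T \<circ> S = id)}"

definition op_sqrt ::
  "('k::rclike \<Rightarrow> 'h::banach \<Rightarrow> 'h) \<Rightarrow> ('h \<Rightarrow> 'h \<Rightarrow> 'k) \<Rightarrow> ('h \<Rightarrow> 'h) \<Rightarrow> 'h \<Rightarrow> 'h" where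
  "op_sqrt smul ip C = (THE R. nonneg_op smul ip R \<and> R \<circ> R = C)"

text \<open>
  Sequences are indexed from 0. Convergence of the series is stated explicitly, since \<open>suminf\<close> is
  arbitrary on divergent series. The upper bound does not involve \<open>K\<close>, hence no operator argument in
  \<open>K_Bessel\<close>.
\<close>

definition K_Bessel :: "('h::banach \<Rightarrow> 'h \<Rightarrow> 'k::rclike) \<Rightarrow> (nat \<Rightarrow> 'h) \<Rightarrow> bool" where
  "K_Bessel ip f \<longleftrightarrow>
     (\<exists>B>0. \<forall>x. summable (\<lambda>n. (norm (ip x (f n)))\<^sup>2) \<and>
                (\<Sum>n. (norm (ip x (f n)))\<^sup>2) \<le> B * (norm x)\<^sup>2)"

definition K_frame ::
  "('h::banach \<Rightarrow> 'h \<Rightarrow> 'k::rclike) \<Rightarrow> ('h \<Rightarrow> 'h) \<Rightarrow> (nat \<Rightarrow> 'h) \<Rightarrow> bool" where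
  "K_frame ip K f \<longleftrightarrow>
     (\<exists>A>0. \<exists>B>0. \<forall>x. summable (\<lambda>n. (norm (ip x (f n)))\<^sup>2) \<and>
        A * (norm (adj ip K x))\<^sup>2 \<le> (\<Sum>n. (norm (ip x (f n)))\<^sup>2) \<and>
        (\<Sum>n. (norm (ip x (f n)))\<^sup>2) \<le> B * (norm x)\<^sup>2)"

text \<open>
  The standing assumptions \<open>C \<in> GL_plus smul ip\<close> and \<open>C \<circ> K = K \<circ> C\<close> are not part of the
  following definition. The real number \<open>s\<close> is the value of the scalar-valued series.
\<close>

definition controlled_K_frame ::
  "('k::rclike \<Rightarrow> 'h::banach \<Rightarrow> 'h) \<Rightarrow> ('h \<Rightarrow> 'h \<Rightarrow> 'k) \<Rightarrow> ('h \<Rightarrow> 'h) \<Rightarrow> ('h \<Rightarrow> 'h) \<Rightarrow> (nat \<Rightarrow> 'h) \<Rightarrow> bool"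
  where
  "controlled_K_frame smul ip C K f \<longleftrightarrow>
     K_Bessel ip f \<and>
     (\<exists>A>0. \<exists>B. \<forall>x. \<exists>s::real.
        (\<lambda>n. ip x (f n) * ip (C (f n)) x) sums of_real s \<and>
        A * (norm (op_sqrt smul ip C (adj ip K x)))\<^sup>2 \<le> s \<and>
        s \<le> B * (norm x)\<^sup>2)"

end

theory Submission
  imports Defs
begin

text \<open>
  Let \<open>S\<close> be the frame operator of \<open>f\<close>. Since \<open>C\<close> commutes with \<open>K K\<^sup>*\<close>, the controlled lower bound says
  that \<open>D = S - A K K\<^sup>*\<close> satisfies \<open>C D + D C \<ge> 0\<close>. As \<open>C\<close> is coercive, this Lyapunov inequality
  forces \<open>D \<ge> 0\<close>: the form of \<open>D\<close> does not increase along the flow \<open>exp (- t C) x\<close>, which tends to \<open>0\<close>.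
  Instead of the flow, single steps \<open>x - h C x\<close> with small \<open>h\<close> are used. The argument does not need \<open>C\<close>
  and \<open>S\<close> to commute, which would fail over the reals.
\<close>

section \<open>Real parts in the scalar field\<close>

text \<open>The class \<open>rclike\<close> has no real part; polarization recovers it from the norm.\<close>
definition re :: "'k::rclike \<Rightarrow> real" where
  "re a = ((norm (a + 1))\<^sup>2 - (norm (a - 1))\<^sup>2) / 4"

lemma conj_zero [simp]: "conj (0::'k::rclike) = 0"
  using conj_add[of "0::'k" 0] by simp

lemma conj_minus: "conj (- a) = - conj (a::'k::rclike)"
  using conj_add[of a "- a"] by (simp add: eq_neg_iff_add_eq_0 add.commute)

lemma conj_diff: "conj (a - b) = conj a - conj (b::'k::rclike)"
  using conj_add[of a "- b"] by (simp add: conj_minus)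

lemma of_real_norm_sq: "of_real ((norm a)\<^sup>2) = a * conj (a::'k::rclike)"
  by (simp add: mult_conj of_real_def)

text \<open>The class does not postulate that \<open>conj\<close> fixes the reals. For real r,
  \<open>mult_conj\<close> yields r * conj r = r^2, and a nonzero r cancels.\<close>

lemma conj_of_real [simp]: "conj (of_real r) = (of_real r :: 'k::rclike)"
proof (cases "r = 0")
  case False
  have "of_real r * conj (of_real r :: 'k) = of_real r * of_real r"
    using of_real_norm_sq[of "of_real r :: 'k"] by (auto simp: power2_eq_square)
  with False show ?thesis by (metis mult_cancel_left of_real_eq_0_iff)
qed simp

lemma conj_one [simp]: "conj (1::'k::rclike) = 1"
  using conj_of_real[of 1, where 'k = 'k] by simp

text \<open>Ties the polarization formula to the usual \<open>a + conj a\<close>. The algebra of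
  \<open>re\<close> is derived from this identity, mostly through \<open>re_eqI\<close>.\<close>

lemma of_real_re: "of_real (2 * re a) = a + conj (a::'k::rclike)"
proof -
  have "of_real (4 * re a) = (a + 1) * conj (a + 1) - (a - 1) * conj (a - 1)"
    unfolding of_real_norm_sq[symmetric] re_def by simp
  also have "\<dots> = 2 * (a + conj a)"
    by (simp add: conj_add conj_diff algebra_simps)
  finally have "2 * of_real (2 * re a) = 2 * (a + conj a)" by simp
  then show ?thesis by (metis mult_cancel_left zero_neq_numeral)
qed

lemma re_eqI: "a + conj a = of_real (2 * r) \<Longrightarrow> re (a::'k::rclike) = r"
  using of_real_re[of a] of_real_eq_iff[of "2 * re a" "2 * r", where 'a = 'k] by simp

lemma re_of_real [simp]: "re (of_real r :: 'k::rclike) = r"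
  by (rule re_eqI) simp

lemma re_zero [simp]: "re (0::'k::rclike) = 0"
  using re_of_real[of 0, where 'k = 'k] by simp

lemma re_conj [simp]: "re (conj a) = re (a::'k::rclike)"
  by (rule re_eqI) (simp only: of_real_re conj_conj add.commute)

lemma re_add: "re (a + b) = re a + re (b::'k::rclike)"
proof (rule re_eqI)
  have "of_real (2 * (re a + re b)) = (of_real (2 * re a) + of_real (2 * re b) :: 'k)"
    by (simp add: algebra_simps)
  also have "\<dots> = (a + b) + conj (a + b)"
    unfolding of_real_re by (simp add: conj_add)
  finally show "(a + b) + conj (a + b) = of_real (2 * (re a + re b))" by simp
qed

lemma re_of_real_mult: "re (of_real r * a) = r * re (a::'k::rclike)"
proof (rule re_eqI)
  have "of_real (2 * (r * re a)) = (of_real r * of_real (2 * re a) :: 'k)" by simp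
  also have "\<dots> = of_real r * a + conj (of_real r * a)"
    unfolding of_real_re by (simp add: conj_mult algebra_simps)
  finally show "of_real r * a + conj (of_real r * a) = of_real (2 * (r * re a))" by simp
qed

lemma re_diff: "re (a - b) = re a - re (b::'k::rclike)"
  using re_add[of "a - b" b] by simp

lemma norm_sq_eq_re: "(norm a)\<^sup>2 = re (a * conj (a::'k::rclike))"
  unfolding of_real_norm_sq[symmetric] by (simp del: of_real_power)

lemma norm_conj [simp]: "norm (conj a) = norm (a::'k::rclike)"
proof -
  have "(norm (conj a))\<^sup>2 = (norm a)\<^sup>2"
    by (simp add: norm_sq_eq_re conj_conj mult.commute)
  then show ?thesis by simp
qed

lemma abs_re_le: "\<bar>re a\<bar> \<le> norm (a::'k::rclike)"
proof -
  have "norm (of_real (2 * re a) :: 'k) \<le> norm a + norm (conj a)"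
    unfolding of_real_re by (rule norm_triangle_ineq)
  then show ?thesis by (simp del: of_real_mult)
qed

lemma bounded_linear_re: "bounded_linear (re :: 'k::rclike \<Rightarrow> real)"
proof (rule bounded_linear_intro)
  show "re (r *\<^sub>R a) = r *\<^sub>R re a" for r and a :: 'k
    by (simp add: scaleR_conv_of_real re_of_real_mult)
  show "norm (re a) \<le> norm a * 1" for a :: 'k
    using abs_re_le[of a] by simp
qed (rule re_add)

text \<open>Expands one summand of the frame series after a step from x to x - h C x.\<close>

lemma norm_diff_of_real_mult_sq:
  fixes a b :: "'k::rclike"
  shows "(norm (a - of_real h * b))\<^sup>2 = (norm a)\<^sup>2 - 2 * h * re (a * conj b) + h\<^sup>2 * (norm b)\<^sup>2"
proof -
  have 1: "(a - of_real h * b) * conj (a - of_real h * b)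
     = a * conj a - of_real h * (a * conj b) - of_real h * conj (a * conj b)
       + of_real (h\<^sup>2) * (b * conj b)"
    by (simp add: conj_diff conj_mult conj_conj algebra_simps power2_eq_square)
  have "(norm (a - of_real h * b))\<^sup>2
     = re (a * conj a) - h * re (a * conj b) - h * re (conj (a * conj b)) + h\<^sup>2 * re (b * conj b)"
    unfolding norm_sq_eq_re 1 re_add re_diff re_of_real_mult ..
  then show ?thesis
    by (simp add: norm_sq_eq_re)
qed

section \<open>Real Hilbert spaces\<close>

text \<open>The real part of \<open>ip\<close> is such a form. Riesz, coercivity and square roots
  are thus treated with real scalars first and carried back through the sublocale
  \<open>rl\<close>.\<close>

locale real_hilbert =
  fixes rip :: "'h::banach \<Rightarrow> 'h \<Rightarrow> real"
  assumes rip_add_left: "rip (x + y) z = rip x z + rip y z"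
    and rip_scaleR_left: "rip (r *\<^sub>R x) y = r * rip x y"
    and rip_commute: "rip x y = rip y x"
    and rip_self: "rip x x = (norm x)\<^sup>2"
begin

lemma rip_add_right: "rip x (y + z) = rip x y + rip x z"
  using rip_add_left rip_commute by metis

lemma rip_scaleR_right: "rip x (r *\<^sub>R y) = r * rip x y"
  using rip_scaleR_left rip_commute by metis

lemma rip_diff_left: "rip (x - y) z = rip x z - rip y z"
  using rip_add_left[of "x - y" y z] by simp

lemma rip_diff_right: "rip x (y - z) = rip x y - rip x z"
  using rip_add_right[of x "y - z" z] by simp

lemmas rip_simps = rip_add_left rip_add_right rip_diff_left rip_diff_right
  rip_scaleR_left rip_scaleR_right

lemma norm_add_scaleR_sq:
  "(norm (x + t *\<^sub>R y))\<^sup>2 = (norm x)\<^sup>2 + 2 * t * rip x y + t\<^sup>2 * (norm y)\<^sup>2"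
  unfolding rip_self[symmetric]
  by (simp add: rip_simps rip_commute[of y x] power2_eq_square algebra_simps)

lemma norm_diff_scaleR_sq:
  "(norm (x - t *\<^sub>R y))\<^sup>2 = (norm x)\<^sup>2 - 2 * t * rip x y + t\<^sup>2 * (norm y)\<^sup>2"
  using norm_add_scaleR_sq[of x "- t" y] by simp

text \<open>Cauchy-Schwarz comes from the triangle inequality, which the norm already satisfies:
  compare the expansion of the squared norm of x + y with the square of the sum of norms.\<close>

lemma rip_le_norm: "rip x y \<le> norm x * norm y"
proof -
  have "(norm (x + y))\<^sup>2 \<le> (norm x + norm y)\<^sup>2"
    by (simp add: norm_triangle_ineq power_mono)
  with norm_add_scaleR_sq[of x 1 y] show ?thesis
    by (simp add: power2_sum)
qed

lemma abs_rip_le: "\<bar>rip x y\<bar> \<le> norm x * norm y"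
  using rip_le_norm[of x y] rip_le_norm[of "- x" y] rip_scaleR_left[of "-1" x y]
  by simp

lemma bounded_linear_rip_left: "bounded_linear (\<lambda>x. rip x y)"
proof (rule bounded_linear_intro)
  show "norm (rip x y) \<le> norm x * norm y" for x
    using abs_rip_le[of x y] by simp
qed (simp_all add: rip_simps)

lemma bounded_linear_rip_right: "bounded_linear (rip x)"
  using bounded_linear_rip_left[of x] by (simp add: rip_commute[of _ x])

section \<open>Riesz representation\<close>

lemma parallelogram:
  fixes x y :: 'h
  shows "(norm (x - y))\<^sup>2 = 2 * (norm x)\<^sup>2 + 2 * (norm y)\<^sup>2 - 4 * (norm ((1/2) *\<^sub>R (x + y)))\<^sup>2"
  unfolding rip_self[symmetric] by (simp add: rip_simps rip_commute[of y x] field_simps)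

lemma nonneg_quadratic_imp_zero:
  fixes a b :: real
  assumes "a \<ge> 0" and "\<And>t. 0 \<le> a * t\<^sup>2 + 2 * t * b"
  shows "b = 0"
proof (rule ccontr)
  assume "b \<noteq> 0"
  \<comment> \<open>Dividing by a + 1 rather than by a also covers a = 0.\<close>
  define t where "t = - b / (a + 1)"
  have b: "b = - (a + 1) * t" using assms(1) by (simp add: t_def field_simps)
  have "0 \<le> a * t\<^sup>2 + 2 * t * b" by (rule assms(2))
  also have "\<dots> = - ((a + 2) * t\<^sup>2)"
    by (simp add: b power2_eq_square algebra_simps)
  also have "\<dots> < 0"
    using assms(1) \<open>b \<noteq> 0\<close> by (simp add: t_def)
  finally show False by simp
qed

text \<open>The representing vector minimizes \<open>\<lambda>x. (norm x)\<^sup>2 - 2 * \<phi> x\<close>; by the parallelogram law,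
  minimizing sequences are Cauchy.\<close>
lemma riesz:
  assumes "bounded_linear \<phi>"
  shows "\<exists>y. \<forall>x. \<phi> x = rip x y"
proof -
  interpret bounded_linear \<phi> by fact
  define J where "J x = (norm x)\<^sup>2 - 2 * \<phi> x" for x
  obtain M where M: "\<And>x. norm (\<phi> x) \<le> norm x * M" using bounded by blast
  have lower: "J x \<ge> - M\<^sup>2" for x
  proof -
    have "\<phi> x \<le> norm x * M" using M[of x] by simp
    moreover have "0 \<le> (norm x - M)\<^sup>2" by simp
    ultimately show ?thesis unfolding J_def by (simp add: power2_diff)
  qed
  have bdd: "bdd_below (range J)" using lower by (auto intro!: bdd_belowI)
  define I where "I = Inf (range J)"
  have I_le: "I \<le> J x" for x
    unfolding I_def using bdd by (intro cInf_lower) auto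
  have "\<exists>x. J x < I + 1 / real (Suc n)" for n
  proof -
    have "Inf (range J) < I + 1 / real (Suc n)" by (simp add: I_def)
    then show ?thesis using cInf_lessD[of "range J"] by blast
  qed
  then obtain X where X: "\<And>n. J (X n) < I + 1 / real (Suc n)" by metis
  have par: "(norm (x - y))\<^sup>2 \<le> 2 * (J x - I) + 2 * (J y - I)" for x y
    using parallelogram[of x y] I_le[of "(1/2) *\<^sub>R (x + y)"]
    by (simp add: J_def scaleR add algebra_simps)
  have "Cauchy X"
  proof (rule metric_CauchyI)
    fix e :: real
    assume "e > 0"
    then obtain N where N: "1 / real (Suc N) < e\<^sup>2 / 4"
      using reals_Archimedean[of "e\<^sup>2 / 4"] by (auto simp: inverse_eq_divide)
    have close: "J (X n) - I < e\<^sup>2 / 4" if "n \<ge> N" for n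
    proof -
      have "1 / real (Suc n) \<le> 1 / real (Suc N)" using that by (simp add: frac_le)
      with X[of n] N show ?thesis by linarith
    qed
    have "dist (X m) (X n) < e" if "m \<ge> N" "n \<ge> N" for m n
    proof -
      have "(norm (X m - X n))\<^sup>2 \<le> 2 * (J (X m) - I) + 2 * (J (X n) - I)" by (rule par)
      also have "\<dots> < 2 * (e\<^sup>2 / 4) + 2 * (e\<^sup>2 / 4)"
        using that by (intro add_strict_mono mult_strict_left_mono close) auto
      finally have "(norm (X m - X n))\<^sup>2 < e\<^sup>2" by simp
      then show ?thesis using \<open>e > 0\<close> by (simp add: dist_norm power_less_imp_less_base)
    qed
    then show "\<exists>N. \<forall>m\<ge>N. \<forall>n\<ge>N. dist (X m) (X n) < e" by blast
  qed
  then obtain y where y: "X \<longlonglongrightarrow> y" using Cauchy_convergent convergentD by blast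
  have lim1: "(\<lambda>n. J (X n)) \<longlonglongrightarrow> J y"
    unfolding J_def by (intro tendsto_intros tendsto y)
  have lim2: "(\<lambda>n. I + 1 / real (Suc n)) \<longlonglongrightarrow> I + 0"
    by (intro tendsto_intros) (use LIMSEQ_inverse_real_of_nat in \<open>simp add: inverse_eq_divide\<close>)
  have Jy: "J y \<le> I"
    using LIMSEQ_le[OF lim1 lim2] X by (auto intro: less_imp_le)
  have "\<phi> x = rip x y" for x
  proof -
    \<comment> \<open>First-order condition at the minimum: J (y + t x) - J y is a quadratic in t
      that is never negative.\<close>
    have "rip y x - \<phi> x = 0"
    proof (rule nonneg_quadratic_imp_zero[of "(norm x)\<^sup>2"])
      show "0 \<le> (norm x)\<^sup>2 * t\<^sup>2 + 2 * t * (rip y x - \<phi> x)" for t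
        using I_le[of "y + t *\<^sub>R x"] Jy
        by (simp add: J_def norm_add_scaleR_sq add scaleR algebra_simps)
    qed simp
    then show ?thesis by (simp add: rip_commute)
  qed
  then show ?thesis by blast
qed

section \<open>Coercive operators\<close>

text \<open>Nonnegativity at x - t C x with t = 1 / M bounds the squared norm of C x by M times the
  form at x. The lower bound on the norm of C x then turns this into coercivity.\<close>

lemma coercive_if_invertible:
  assumes lin: "bounded_linear C" and sym: "\<And>x y. rip (C x) y = rip x (C y)"
    and nonneg: "\<And>x. rip (C x) x \<ge> 0"
    and inv: "\<And>x. norm x \<le> L * norm (C x)"
  shows "\<exists>c>0. \<forall>x. c * (norm x)\<^sup>2 \<le> rip (C x) x"
proof -
  interpret bounded_linear C by fact
  obtain M where M: "M > 0" "\<And>x. norm (C x) \<le> norm x * M" using pos_bounded by blast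
  have key: "(norm (C x))\<^sup>2 \<le> M * rip (C x) x" for x
  proof -
    define t where "t = 1 / M"
    have "0 \<le> rip (C (x - t *\<^sub>R C x)) (x - t *\<^sub>R C x)" by (rule nonneg)
    also have "\<dots> = rip (C x) x - 2 * t * (norm (C x))\<^sup>2 + t\<^sup>2 * rip (C (C x)) (C x)"
      unfolding rip_self[symmetric]
      by (simp add: diff scaleR rip_simps sym[of "C x" x] power2_eq_square algebra_simps)
    also have "rip (C (C x)) (C x) \<le> M * (norm (C x))\<^sup>2"
      using rip_le_norm[of "C (C x)" "C x"] mult_right_mono[OF M(2)[of "C x"], of "norm (C x)"]
      by (simp add: power2_eq_square algebra_simps)
    then have "t\<^sup>2 * rip (C (C x)) (C x) \<le> t\<^sup>2 * (M * (norm (C x))\<^sup>2)"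
      by (intro mult_left_mono) auto
    also have "t\<^sup>2 * (M * (norm (C x))\<^sup>2) = t * (norm (C x))\<^sup>2"
      using M(1) by (simp add: t_def power2_eq_square)
    finally have "t * (norm (C x))\<^sup>2 \<le> rip (C x) x" by simp
    then show ?thesis using M(1) by (simp add: t_def field_simps)
  qed
  \<comment> \<open>The summand 1 keeps the denominator positive whatever L is.\<close>
  define c where "c = 1 / ((L\<^sup>2 + 1) * M)"
  have pos: "(L\<^sup>2 + 1) * M > 0" using M(1) by (simp add: add_nonneg_pos)
  have "c * (norm x)\<^sup>2 \<le> rip (C x) x" for x
  proof -
    have "(norm x)\<^sup>2 \<le> (L * norm (C x))\<^sup>2" using inv[of x] by (simp add: power_mono)
    also have "\<dots> \<le> (L\<^sup>2 + 1) * (norm (C x))\<^sup>2"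
      by (simp add: power_mult_distrib algebra_simps)
    also have "\<dots> \<le> (L\<^sup>2 + 1) * (M * rip (C x) x)"
      using key[of x] by (intro mult_left_mono) auto
    finally have "(norm x)\<^sup>2 \<le> rip (C x) x * ((L\<^sup>2 + 1) * M)" by (simp add: algebra_simps)
    then show ?thesis using pos by (simp add: c_def pos_divide_le_eq)
  qed
  moreover have "c > 0" using pos by (simp add: c_def)
  ultimately show ?thesis by blast
qed

text \<open>Serves twice: it brings a multiple of C close to the identity for the square root, and
  it supplies the shrinking of norms in the descent.\<close>

lemma norm_diff_coercive_sq_le:
  assumes "\<And>x. c * (norm x)\<^sup>2 \<le> rip (C x) x" and "\<And>x. norm (C x) \<le> M * norm x"
    and "h \<ge> 0"
  shows "(norm (x - h *\<^sub>R C x))\<^sup>2 \<le> (1 - 2 * h * c + h\<^sup>2 * M\<^sup>2) * (norm x)\<^sup>2"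
proof -
  have "2 * h * (c * (norm x)\<^sup>2) \<le> 2 * h * rip (C x) x"
    using assms(1)[of x] assms(3) by (intro mult_left_mono) auto
  moreover have "h\<^sup>2 * (norm (C x))\<^sup>2 \<le> h\<^sup>2 * (M * norm x)\<^sup>2"
    using assms(2)[of x] by (intro mult_left_mono power_mono) auto
  ultimately show ?thesis
    unfolding norm_diff_scaleR_sq rip_commute[of x]
    by (simp add: power_mult_distrib algebra_simps)
qed

section \<open>Square roots of coercive operators\<close>

text \<open>The last clause puts R in the double commutant of C. It gives uniqueness, and later
  linearity of R over the full scalar field, by taking scalar multiplications for Z.\<close>

definition coercive_root :: "('h \<Rightarrow> 'h) \<Rightarrow> ('h \<Rightarrow> 'h) \<Rightarrow> bool" where
  "coercive_root C R \<longleftrightarrow>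
     bounded_linear R \<and> (\<forall>x. R (R x) = C x) \<and> (\<forall>x y. rip (R x) y = rip x (R y)) \<and>
     (\<exists>d>0. \<forall>x. d * (norm x)\<^sup>2 \<le> rip (R x) x) \<and>
     (\<forall>Z. bounded_linear Z \<longrightarrow> (\<forall>x. Z (C x) = C (Z x)) \<longrightarrow> (\<forall>x. Z (R x) = R (Z x)))"

lemma coercive_rootI:
  assumes "bounded_linear R" "\<And>x. R (R x) = C x" "\<And>x y. rip (R x) y = rip x (R y)"
    and "d > 0" "\<And>x. d * (norm x)\<^sup>2 \<le> rip (R x) x"
    and "\<And>Z x. bounded_linear Z \<Longrightarrow> (\<And>x. Z (C x) = C (Z x)) \<Longrightarrow> Z (R x) = R (Z x)"
  shows "coercive_root C R"
  unfolding coercive_root_def using assms by blast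

lemma coercive_rootD:
  assumes "coercive_root C R"
  shows "bounded_linear R" "R (R x) = C x" "rip (R x) y = rip x (R y)"
    "\<exists>d>0. \<forall>x. d * (norm x)\<^sup>2 \<le> rip (R x) x"
    "bounded_linear Z \<Longrightarrow> (\<And>x. Z (C x) = C (Z x)) \<Longrightarrow> Z (R x) = R (Z x)"
  using assms unfolding coercive_root_def by blast+

text \<open>For \<open>B = I - C\<close> a root of \<open>C\<close> is \<open>I - Y\<close> with \<open>Y\<close> a fixed point of \<open>Y \<mapsto> (B + Y\<^sup>2) / 2\<close>, which
  contracts the ball of radius \<open>norm B\<close>.\<close>
lemma sqrt_near_identity:
  assumes lin: "bounded_linear C" and sym: "\<And>x y. rip (C x) y = rip x (C y)"
    and \<rho>: "0 \<le> \<rho>" "\<rho> < 1" and near: "\<And>x. norm (x - C x) \<le> \<rho> * norm x"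
  shows "\<exists>R. coercive_root C R"
proof -
  interpret C: bounded_linear C by fact
  define B where "B = Blinfun (\<lambda>x. x - C x)"
  have B: "blinfun_apply B x = x - C x" for x
    unfolding B_def
    by (subst bounded_linear_Blinfun_apply) (auto intro!: bounded_linear_sub bounded_linear_ident lin)
  have normB: "norm B \<le> \<rho>"
    using near by (intro norm_blinfun_bound \<rho>) (simp add: B)
  define P where "P Z \<longleftrightarrow> (\<forall>x. blinfun_apply Z (C x) = C (blinfun_apply Z x))"
    for Z :: "'h \<Rightarrow>\<^sub>L 'h"
  \<comment> \<open>Symmetry and the commutation property are closed conditions preserved by F, so
    building them into the complete set hands them to the fixed point.\<close>
  define S where "S = {Y :: 'h \<Rightarrow>\<^sub>L 'h. norm Y \<le> \<rho>} \<inter>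
     {Y. \<forall>x y. rip (blinfun_apply Y x) y = rip x (blinfun_apply Y y)} \<inter>
     {Y. \<forall>Z x. P Z \<longrightarrow> blinfun_apply Z (blinfun_apply Y x) = blinfun_apply Y (blinfun_apply Z x)}"
  define F where "F Y = (1/2) *\<^sub>R (B + (Y o\<^sub>L Y))" for Y
  have Fapp: "blinfun_apply (F Y) x = (1/2) *\<^sub>R ((x - C x) + Y (Y x))" for Y x
    by (simp add: F_def blinfun.add_left blinfun.scaleR_left B)
  have "closed S"
  proof -
    have c1: "continuous_on UNIV (\<lambda>Y :: 'h \<Rightarrow>\<^sub>L 'h. rip (Y x) y)" for x y
      by (intro bounded_linear.continuous_on[OF bounded_linear_rip_left] continuous_intros)
    have c2: "continuous_on UNIV (\<lambda>Y :: 'h \<Rightarrow>\<^sub>L 'h. rip x (Y y))" for x y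
      by (intro bounded_linear.continuous_on[OF bounded_linear_rip_right] continuous_intros)
    have "closed {Y :: 'h \<Rightarrow>\<^sub>L 'h. P Z \<longrightarrow> Z (Y x) = Y (Z x)}" for Z x
      by (cases "P Z") (auto intro!: closed_Collect_eq continuous_intros)
    then show ?thesis
      unfolding S_def
      by (intro closed_Int closed_Collect_all closed_Collect_eq closed_Collect_le
          c1 c2 continuous_intros)
  qed
  then have "complete S" by (simp add: complete_eq_closed)
  moreover have "0 \<in> S" using \<rho> rip_scaleR_left[of 0] rip_scaleR_right[of _ 0]
    by (auto simp: S_def blinfun.zero_right)
  moreover have "F ` S \<subseteq> S"
  proof (rule image_subsetI)
    fix Y assume Y: "Y \<in> S"
    have "norm (F Y) \<le> (norm B + norm (Y o\<^sub>L Y)) / 2"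
      using norm_triangle_ineq[of B "Y o\<^sub>L Y"] by (simp add: F_def)
    also have "\<dots> \<le> (\<rho> + \<rho> * \<rho>) / 2"
      using normB norm_blinfun_compose[of Y Y] mult_mono[of "norm Y" \<rho> "norm Y" \<rho>] Y \<rho>
      by (simp add: S_def)
    also have "\<dots> \<le> \<rho>" using \<rho> mult_left_mono[of \<rho> 1 \<rho>] by simp
    finally have 1: "norm (F Y) \<le> \<rho>" .
    have 2: "rip (F Y x) y = rip x (F Y y)" for x y
    proof -
      have "rip (Y (Y x)) y = rip x (Y (Y y))" using Y by (simp add: S_def)
      then show ?thesis by (simp add: Fapp rip_simps sym)
    qed
    have 3: "Z (F Y x) = F Y (Z x)" if "P Z" for Z x
    proof -
      have "Z (Y (Y x)) = Y (Y (Z x))" using Y that by (simp add: S_def)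
      moreover have "Z (C x) = C (Z x)" using that by (simp add: P_def)
      ultimately show ?thesis
        by (simp add: Fapp blinfun.add_right blinfun.diff_right blinfun.scaleR_right)
    qed
    show "F Y \<in> S" unfolding S_def using 1 2 3 by blast
  qed
  moreover have "dist (F Y) (F Z) \<le> \<rho> * dist Y Z" if "Y \<in> S" "Z \<in> S" for Y Z
  proof -
    \<comment> \<open>Y^2 - Z^2 = Y (Y - Z) + (Y - Z) Z, a splitting valid without
      commutation.\<close>
    have eq: "F Y - F Z = (1/2) *\<^sub>R ((Y o\<^sub>L (Y - Z)) + ((Y - Z) o\<^sub>L Z))"
      by (rule blinfun_eqI)
        (simp add: Fapp blinfun.add_left blinfun.diff_left blinfun.diff_right blinfun.scaleR_left
          algebra_simps)
    have "norm (F Y - F Z) \<le> (norm (Y o\<^sub>L (Y - Z)) + norm ((Y - Z) o\<^sub>L Z)) / 2"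
      unfolding eq using norm_triangle_ineq by simp
    also have "\<dots> \<le> (norm Y * norm (Y - Z) + norm (Y - Z) * norm Z) / 2"
      by (intro divide_right_mono add_mono norm_blinfun_compose) simp
    also have "\<dots> \<le> (\<rho> * norm (Y - Z) + norm (Y - Z) * \<rho>) / 2"
      using that by (intro divide_right_mono add_mono mult_left_mono mult_right_mono)
        (auto simp: S_def)
    finally show ?thesis by (simp add: dist_norm)
  qed
  ultimately have "\<exists>!Y\<in>S. F Y = Y"
    using \<rho> by (intro Banach_fix[of S \<rho> F]) auto
  then obtain Y where Y: "Y \<in> S" "F Y = Y" by blast
  define R where "R x = x - blinfun_apply Y x" for x
  \<comment> \<open>The fixed point equation reads 2 Y = B + Y^2, so that (I - Y)^2 = I - B =
    C.\<close>
  have fixp: "2 *\<^sub>R Y x = (x - C x) + Y (Y x)" for x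
    by (subst (1) Y(2)[symmetric], unfold Fapp) simp
  have "coercive_root C R"
  proof (rule coercive_rootI)
    show "bounded_linear R"
      unfolding R_def by (intro bounded_linear_sub bounded_linear_ident blinfun.bounded_linear_right)
    show "R (R x) = C x" for x
      using fixp[of x] by (simp add: R_def blinfun.diff_right algebra_simps scaleR_2)
    show "rip (R x) y = rip x (R y)" for x y
      using Y(1) by (simp add: R_def rip_simps S_def)
    show "1 - \<rho> > 0" using \<rho> by simp
    show "(1 - \<rho>) * (norm x)\<^sup>2 \<le> rip (R x) x" for x
    proof -
      have "rip (Y x) x \<le> norm (Y x) * norm x" by (rule rip_le_norm)
      also have "\<dots> \<le> (norm Y * norm x) * norm x"
        by (intro mult_right_mono norm_blinfun) simp
      also have "\<dots> \<le> (\<rho> * norm x) * norm x"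
        using Y(1) by (intro mult_right_mono) (auto simp: S_def)
      finally show ?thesis
        by (simp add: R_def rip_simps rip_self power2_eq_square algebra_simps)
    qed
    show "Z (R x) = R (Z x)"
      if "bounded_linear Z" "\<And>x. Z (C x) = C (Z x)" for Z x
    proof -
      have "Z (Y x) = Y (Z x)"
        using Y(1) that bounded_linear_Blinfun_apply[OF that(1)]
        by (auto simp: S_def P_def dest!: spec[of _ "Blinfun Z"])
      then show ?thesis by (simp add: R_def linear_diff[OF bounded_linear.linear[OF that(1)]])
    qed
  qed
  then show ?thesis by blast
qed

text \<open>A suitable multiple h C lies within \<rho> < 1 of the identity; its root divided by
  \<open>sqrt h\<close> is a root of C.\<close>

lemma coercive_sqrt:
  assumes lin: "bounded_linear C" and sym: "\<And>x y. rip (C x) y = rip x (C y)"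
    and c: "c > 0" "\<And>x. c * (norm x)\<^sup>2 \<le> rip (C x) x"
  shows "\<exists>R. coercive_root C R"
proof -
  interpret C: bounded_linear C by fact
  obtain M0 where M0: "M0 > 0" "\<And>x. norm (C x) \<le> norm x * M0" using C.pos_bounded by blast
  \<comment> \<open>The maximum ensures c \<le> M, so that the radicand in \<rho> below is
    nonnegative.\<close>
  define M where "M = max M0 c"
  have M: "M > 0" "c \<le> M" using M0(1) by (auto simp: M_def)
  have CM: "norm (C x) \<le> M * norm x" for x
    using M0(2)[of x] mult_left_mono[of M0 M "norm x"] by (simp add: M_def mult.commute)
  \<comment> \<open>This h minimizes 1 - 2 h c + h^2 M^2, with minimum 1 - c^2 / M^2.\<close>
  define h where "h = c / M\<^sup>2"
  have h: "h > 0" using c(1) M by (simp add: h_def)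
  define \<rho> where "\<rho> = sqrt (1 - c\<^sup>2 / M\<^sup>2)"
  have q: "c\<^sup>2 / M\<^sup>2 > 0" "c\<^sup>2 / M\<^sup>2 \<le> 1"
    using c(1) M by (auto simp: power_mono)
  then have \<rho>: "0 \<le> \<rho>" "\<rho> < 1" by (auto simp: \<rho>_def)
  have "norm (x - h *\<^sub>R C x) \<le> \<rho> * norm x" for x
  proof -
    have "1 - 2 * h * c + h\<^sup>2 * M\<^sup>2 = 1 - c\<^sup>2 / M\<^sup>2"
      using M(1) by (simp add: h_def field_simps power2_eq_square)
    also have "\<dots> = \<rho>\<^sup>2" using q by (simp add: \<rho>_def)
    finally have eq: "1 - 2 * h * c + h\<^sup>2 * M\<^sup>2 = \<rho>\<^sup>2" .
    have "(norm (x - h *\<^sub>R C x))\<^sup>2 \<le> (\<rho> * norm x)\<^sup>2"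
      using norm_diff_coercive_sq_le[OF c(2) CM, of h x] h unfolding eq power_mult_distrib by simp
    then show ?thesis by (rule power2_le_imp_le) (use \<rho> in simp)
  qed
  moreover have "bounded_linear (\<lambda>x. h *\<^sub>R C x)"
    by (rule bounded_linear_compose[OF bounded_linear_scaleR_right lin])
  moreover have "rip (h *\<^sub>R C x) y = rip x (h *\<^sub>R C y)" for x y
    by (simp add: rip_simps sym)
  ultimately obtain R where root: "coercive_root (\<lambda>x. h *\<^sub>R C x) R"
    using sqrt_near_identity[of "\<lambda>x. h *\<^sub>R C x" \<rho>] \<rho> by blast
  note R = coercive_rootD[OF root]
  obtain d where d: "d > 0" "\<And>x. d * (norm x)\<^sup>2 \<le> rip (R x) x" using R(4) by blast
  interpret R: bounded_linear R by (rule R(1))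
  define r where "r = 1 / sqrt h"
  have r: "r > 0" "r * (r * h) = 1" using h by (auto simp: r_def)
  have "coercive_root C (\<lambda>x. r *\<^sub>R R x)"
  proof (rule coercive_rootI)
    show "bounded_linear (\<lambda>x. r *\<^sub>R R x)"
      by (rule bounded_linear_compose[OF bounded_linear_scaleR_right R(1)])
    show "r *\<^sub>R R (r *\<^sub>R R x) = C x" for x
      using r by (simp add: R.scaleR R(2))
    show "rip (r *\<^sub>R R x) y = rip x (r *\<^sub>R R y)" for x y
      by (simp add: rip_simps R(3))
    show "r * d > 0" using r d by simp
    show "(r * d) * (norm x)\<^sup>2 \<le> rip (r *\<^sub>R R x) x" for x
      using d(2)[of x] r(1) by (simp add: rip_simps)
    show "Z (r *\<^sub>R R x) = r *\<^sub>R R (Z x)"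
      if "bounded_linear Z" "\<And>x. Z (C x) = C (Z x)" for Z x
      using R(5)[OF that(1)] that(2)
      by (simp add: linear_scale[OF bounded_linear.linear[OF that(1)]])
  qed
  then show ?thesis by blast
qed

text \<open>T commutes with its square C, hence with R. So R + T sends z = R x - T x to C x - C x =
  0, and coercivity of R with nonnegativity of T forces z = 0.\<close>

lemma coercive_root_unique:
  assumes "coercive_root C R"
    and T: "bounded_linear T" "\<And>x. T (T x) = C x" "\<And>x. rip (T x) x \<ge> 0"
  shows "T = R"
proof
  fix x
  note R = coercive_rootD[OF assms(1)]
  obtain d where d: "d > 0" "\<And>x. d * (norm x)\<^sup>2 \<le> rip (R x) x" using R(4) by blast
  interpret R: bounded_linear R by (rule R(1))
  interpret T: bounded_linear T by fact
  have comm: "T (R x) = R (T x)" for x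
    by (rule R(5)[OF T(1)]) (simp flip: T(2))
  define z where "z = R x - T x"
  have "R z + T z = 0"
    by (simp add: z_def R.diff T.diff comm R(2) T(2))
  then have "rip (R z) z + rip (T z) z = 0"
    using rip_add_left[of "R z" "T z" z] rip_scaleR_left[of 0 0 z] by simp
  then have "d * (norm z)\<^sup>2 \<le> 0" using d(2)[of z] T(3)[of z] by linarith
  then show "T x = R x" using \<open>d > 0\<close> by (simp add: z_def mult_le_0_iff)
qed

end

section \<open>Descent for a quadratic form\<close>

text \<open>The best constant \<open>e \<ge> 0\<close> with \<open>q x \<ge> - e * (norm x)\<^sup>2\<close> could be improved by a step
  \<open>x - h *\<^sub>R C x\<close>: the norm shrinks to first order in \<open>h\<close>, while \<open>q\<close> grows to second order only.\<close>
lemma form_nonneg_by_descent: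
  fixes q :: "'h::real_normed_vector \<Rightarrow> real"
  assumes c: "c > 0"
    and shrink: "\<And>h x. h \<ge> 0 \<Longrightarrow> (norm (x - h *\<^sub>R C x))\<^sup>2 \<le> (1 - 2 * h * c + h\<^sup>2 * N) * (norm x)\<^sup>2"
    and growth: "\<And>h x. h \<ge> 0 \<Longrightarrow> q (x - h *\<^sub>R C x) \<le> q x + h\<^sup>2 * M * (norm x)\<^sup>2"
    and lower: "\<And>x. - e1 * (norm x)\<^sup>2 \<le> q x"
    and nonneg: "e1 \<ge> 0" "M \<ge> 0" "N \<ge> 0"
  shows "q x \<ge> 0"
proof -
  define E where "E = {e. e \<ge> 0 \<and> (\<forall>x. - e * (norm x)\<^sup>2 \<le> q x)}"
  define e where "e = Inf E"
  have "e1 \<in> E" using lower nonneg by (simp add: E_def)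
  have bdd: "bdd_below E" by (auto simp: E_def intro!: bdd_belowI[of _ 0])
  have "closed E"
    unfolding E_def
    by (intro closed_Collect_conj closed_Collect_all closed_Collect_le continuous_intros)
  then have eE: "e \<in> E" unfolding e_def
    using closed_contains_Inf[of E] \<open>e1 \<in> E\<close> bdd by blast
  then have e: "e \<ge> 0" "\<And>x. - e * (norm x)\<^sup>2 \<le> q x" by (auto simp: E_def)
  have step: "2 * c * e \<le> h * (N * e + M)" if h: "0 < h" "h \<le> 1 / (2 * c)" for h
  proof -
    define e' where "e' = e * (1 - 2 * h * c + h\<^sup>2 * N) + h\<^sup>2 * M"
    \<comment> \<open>The restriction on h is there to give e' \<ge> 0, which membership in E
      demands.\<close>
    have "2 * h * c \<le> 1" using h c by (simp add: field_simps)
    then have "e' \<ge> 0" using e nonneg by (simp add: e'_def)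
    moreover have "- e' * (norm x)\<^sup>2 \<le> q x" for x
    proof -
      have "e * (norm (x - h *\<^sub>R C x))\<^sup>2 \<le> e * ((1 - 2 * h * c + h\<^sup>2 * N) * (norm x)\<^sup>2)"
        using shrink[of h x] h e by (intro mult_left_mono) auto
      then have "- (e * ((1 - 2 * h * c + h\<^sup>2 * N) * (norm x)\<^sup>2)) \<le> q x + h\<^sup>2 * M * (norm x)\<^sup>2"
        using e(2)[of "x - h *\<^sub>R C x"] growth[of h x] h by linarith
      then show ?thesis by (simp add: e'_def algebra_simps)
    qed
    ultimately have "e' \<in> E" by (simp add: E_def)
    then have "e \<le> e'" unfolding e_def using bdd by (rule cInf_lower)
    \<comment> \<open>The term e cancels on both sides of e \<le> e', leaving a factor h to divide
      out; letting h tend to 0 then gives 2 c e \<le> 0.\<close>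
    then have "h * (2 * c * e) \<le> h * (h * (N * e + M))"
      by (simp add: e'_def algebra_simps power2_eq_square)
    then show ?thesis using h by simp
  qed
  have "((\<lambda>h. h * (N * e + M)) \<longlongrightarrow> 0 * (N * e + M)) (at_right 0)"
    by (intro tendsto_intros)
  moreover have "eventually (\<lambda>h. 2 * c * e \<le> h * (N * e + M)) (at_right 0)"
  proof (rule eventually_mono)
    show "eventually (\<lambda>h. h \<in> {0<..<1 / (2 * c)}) (at_right 0)"
      using c by (intro eventually_at_right_real) simp
  qed (auto intro: step)
  ultimately have "2 * c * e \<le> 0"
    by (metis tendsto_lowerbound trivial_limit_at_right_real mult_zero_left)
  then have "e = 0" using c e by (simp add: mult_le_0_iff)
  then show ?thesis using e(2)[of x] by simp
qed

section \<open>Adjoints and square roots over the scalar field\<close>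

context hilbert_space
begin

lemma ip_scaleR_left: "ip (r *\<^sub>R x) y = of_real r * ip x y"
  by (metis ip_smul_left smul_of_real)

lemma ip_diff_left: "ip (x - y) z = ip x z - ip y z"
  using ip_add_left[of "x - y" y z] by simp

lemma ip_zero_left [simp]: "ip 0 x = 0"
  using ip_add_left[of 0 0 x] by simp

lemma norm_smul: "norm (smul a x) = norm a * norm x"
proof -
  have "ip (smul a x) (smul a x) = a * conj a * ip x x"
    by (metis ip_smul_left ip_commute conj_mult mult.assoc mult.left_commute)
  then have "of_real ((norm (smul a x))\<^sup>2) = (of_real ((norm a * norm x)\<^sup>2) :: 'k)"
    unfolding ip_self of_real_norm_sq[symmetric] by (simp add: power_mult_distrib)
  then have "(norm (smul a x))\<^sup>2 = (norm a * norm x)\<^sup>2"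
    unfolding of_real_eq_iff .
  then show ?thesis by simp
qed

sublocale rl: real_hilbert "\<lambda>x y. re (ip x y)"
proof
  show "re (ip x y) = re (ip y x)" for x y
    by (metis ip_commute re_conj)
qed (simp_all add: ip_add_left re_add ip_scaleR_left re_of_real_mult ip_self del: of_real_power)

lemma ip_eqI:
  assumes "\<And>x. re (ip x u) = re (ip x v)"
  shows "u = v"
proof -
  have "(norm (u - v))\<^sup>2 = 0"
    unfolding rl.rip_self[symmetric] using assms[of "u - v"] by (simp add: rl.rip_diff_right)
  then show ?thesis by simp
qed

lemma bounded_op_linear:
  assumes "bounded_op smul T"
  shows "T (x + y) = T x + T y" "T (smul a x) = smul a (T x)" "T (r *\<^sub>R x) = r *\<^sub>R T x"
proof -
  interpret T: Vector_Spaces.linear smul smul T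
    using assms by (simp add: bounded_op_def)
  show "T (x + y) = T x + T y" "T (smul a x) = smul a (T x)" for x y a
    by (simp_all add: T.add T.scale)
  then show "T (r *\<^sub>R x) = r *\<^sub>R T x" by (metis smul_of_real)
qed

lemma bounded_op_bounded_linear:
  assumes "bounded_op smul T"
  shows "bounded_linear T"
proof -
  obtain M where "\<And>x. norm (T x) \<le> M * norm x" using assms by (auto simp: bounded_op_def)
  then show ?thesis
    by (intro bounded_linear_intro[where K = M])
      (simp_all add: bounded_op_linear[OF assms] mult.commute)
qed

lemma bounded_opI:
  assumes "bounded_linear T" and "\<And>a x. T (smul a x) = smul a (T x)"
  shows "bounded_op smul T"
proof -
  interpret bounded_linear T by fact
  have "Vector_Spaces.linear smul smul T"
    by unfold_locales (simp_all add: add assms(2) scale_right_distrib scale_left_distrib)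
  moreover obtain M where "\<And>x. norm (T x) \<le> norm x * M" using bounded by blast
  ultimately show ?thesis
    unfolding bounded_op_def by (metis mult.commute)
qed

lemma bounded_linear_smul: "bounded_linear (smul a)"
proof (rule bounded_linear_intro)
  show "smul a (r *\<^sub>R x) = r *\<^sub>R smul a x" for r x
    by (metis smul_of_real scale_left_commute)
  show "norm (smul a x) \<le> norm x * norm a" for x
    by (simp add: norm_smul)
qed (rule scale_right_distrib)

text \<open>With g the difference of both sides, replacing x by \<open>smul (conj g) x\<close> turns
  equality of real parts into vanishing of the squared norm of g.\<close>

lemma ip_eq_if_re_eq:
  assumes lin: "\<And>a x. T (smul a x) = smul a (T x)"
    and re: "\<And>x. re (ip (T x) y) = re (ip x z)"
  shows "ip (T x) y = ip x z"
proof -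
  define g where "g = ip (T x) y - ip x z"
  have "re (conj g * g) = 0"
    using re[of "smul (conj g) x"] unfolding lin ip_smul_left
    by (simp add: g_def right_diff_distrib re_diff)
  then have "(norm g)\<^sup>2 = 0" by (simp add: norm_sq_eq_re mult.commute)
  then show ?thesis by (simp add: g_def)
qed

lemma adj_eqI:
  assumes "\<And>x y. ip (T x) y = ip x (S y)"
  shows "adj ip T = S"
  unfolding adj_def
proof (rule the_equality)
  show "\<forall>x y. ip (T x) y = ip x (S y)" using assms by blast
  fix S' assume "\<forall>x y. ip (T x) y = ip x (S' y)"
  then have "ip x (S' y) = ip x (S y)" for x y using assms by metis
  then show "S' = S" by (intro ext ip_eqI) simp
qed

text \<open>Shows that the description in \<open>adj\<close> denotes: Riesz represents the real
  part, and \<open>ip_eq_if_re_eq\<close> lifts the relation to the scalar field.\<close>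

lemma ip_adj:
  assumes "bounded_op smul T"
  shows "ip (T x) y = ip x (adj ip T y)"
proof -
  have "\<exists>z. \<forall>x. re (ip (T x) y) = re (ip x z)" for y
    by (rule rl.riesz, rule bounded_linear_compose[OF rl.bounded_linear_rip_left
          bounded_op_bounded_linear[OF assms]])
  then obtain S where "\<And>x y. re (ip (T x) y) = re (ip x (S y))" by metis
  then have "\<And>x y. ip (T x) y = ip x (S y)"
    using bounded_op_linear(2)[OF assms] by (intro ip_eq_if_re_eq)
  then show ?thesis using adj_eqI by metis
qed

lemma self_adjoint_iff:
  "self_adjoint smul ip T \<longleftrightarrow> bounded_op smul T \<and> (\<forall>x y. ip (T x) y = ip x (T y))"
  unfolding self_adjoint_def using ip_adj adj_eqI by metis

text \<open>The bound comes from pairing \<open>?S y\<close> with itself and moving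
  \<open>?S\<close> back to T. Linearity over the reals is what steps with real h call for.\<close>

lemma adj_bounded_linear:
  assumes "bounded_op smul T"
  shows "bounded_linear (adj ip T)"
proof -
  let ?S = "adj ip T"
  note adj = ip_adj[OF assms, symmetric]
  obtain M where M: "M > 0" "\<And>x. norm (T x) \<le> norm x * M"
    using bounded_linear.pos_bounded[OF bounded_op_bounded_linear[OF assms]] by blast
  have "norm (?S y) \<le> norm y * M" for y
  proof (cases "?S y = 0")
    case False
    have "norm (?S y) * norm (?S y) = re (ip (T (?S y)) y)"
      using rl.rip_self[of "?S y"] by (simp add: adj power2_eq_square)
    also have "\<dots> \<le> norm (T (?S y)) * norm y" by (rule rl.rip_le_norm)
    also have "\<dots> \<le> (norm (?S y) * M) * norm y" using M by (intro mult_right_mono) auto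
    also have "\<dots> = norm (?S y) * (norm y * M)" by simp
    finally show ?thesis using False by simp
  qed (use M in simp)
  moreover have "?S (x + y) = ?S x + ?S y" for x y
    by (rule ip_eqI) (simp add: adj rl.rip_add_right)
  moreover have "?S (r *\<^sub>R x) = r *\<^sub>R ?S x" for r x
    by (rule ip_eqI) (simp add: adj rl.rip_scaleR_right)
  ultimately show ?thesis by (intro bounded_linear_intro)
qed

section \<open>Operators in \<open>GL_plus\<close> and their roots\<close>

lemma GL_plus_coercive:
  assumes "C \<in> GL_plus smul ip"
  shows "bounded_op smul C" "ip (C x) y = ip x (C y)"
    "\<exists>c>0. \<forall>x. c * (norm x)\<^sup>2 \<le> re (ip (C x) x)"
proof -
  from assms show bop: "bounded_op smul C" and "ip (C x) y = ip x (C y)"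
    by (auto simp: GL_plus_def positive_op_def self_adjoint_iff)
  from assms obtain S where S: "bounded_op smul S" "S \<circ> C = id"
    by (auto simp: GL_plus_def)
  then obtain L where L: "\<And>x. norm (S x) \<le> L * norm x" by (auto simp: bounded_op_def)
  show "\<exists>c>0. \<forall>x. c * (norm x)\<^sup>2 \<le> re (ip (C x) x)"
  proof (rule rl.coercive_if_invertible)
    show "bounded_linear C" using bop by (rule bounded_op_bounded_linear)
    show "re (ip (C x) y) = re (ip x (C y))" for x y
      using assms by (simp add: GL_plus_def positive_op_def self_adjoint_iff)
    show "re (ip (C x) x) \<ge> 0" for x
    proof (cases "x = 0")
      case True
      \<comment> \<open>\<open>positive_op\<close> speaks only of nonzero vectors, so 0 is handled
        separately.\<close>
      then show ?thesis by (metis order_refl re_zero ip_zero_left ip_commute conj_zero)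
    next
      case False
      then obtain r where "r > 0" "ip (C x) x = of_real r"
        using assms by (auto simp: GL_plus_def positive_op_def)
      then show ?thesis by simp
    qed
    show "norm x \<le> L * norm (C x)" for x
      using L[of "C x"] S(2) by (metis comp_apply id_apply)
  qed
qed

text \<open>Existence and uniqueness of the coercive root make the description in
  \<open>op_sqrt\<close> denote; symmetry of the root then eliminates it from the controlled lower
  bound.\<close>

lemma norm_op_sqrt_sq:
  assumes "C \<in> GL_plus smul ip"
  shows "(norm (op_sqrt smul ip C x))\<^sup>2 = re (ip (C x) x)"
proof -
  note C = GL_plus_coercive[OF assms]
  obtain c where c: "c > 0" "\<And>x. c * (norm x)\<^sup>2 \<le> re (ip (C x) x)" using C(3) by blast
  have "\<exists>R. rl.coercive_root C R"
    by (rule rl.coercive_sqrt[OF bounded_op_bounded_linear[OF C(1)] _ c]) (simp add: C(2))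
  then obtain R where root: "rl.coercive_root C R" by blast
  note R = rl.coercive_rootD[OF root]
  obtain d where d: "d > 0" "\<And>x. d * (norm x)\<^sup>2 \<le> re (ip (R x) x)" using R(4) by blast
  \<comment> \<open>Scalar multiplications commute with C, hence with R.\<close>
  have smul: "R (smul a x) = smul a (R x)" for a x
    using R(5)[OF bounded_linear_smul[of a]] bounded_op_linear(2)[OF C(1)] by simp
  have sym: "ip (R x) y = ip x (R y)" for x y
    by (rule ip_eq_if_re_eq) (simp_all add: smul R(3))
  have real: "ip (R x) x = of_real (re (ip (R x) x))" for x
  proof -
    have "conj (ip (R x) x) = ip (R x) x" by (metis ip_commute sym)
    then have "2 * of_real (re (ip (R x) x)) = 2 * ip (R x) x"
      using of_real_re[of "ip (R x) x"] by (simp only: mult_2 of_real_add)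
    then show ?thesis by (metis mult_cancel_left zero_neq_numeral)
  qed
  have "re (ip (R x) x) \<ge> 0" for x
    using d(2)[of x] d(1) by (meson mult_nonneg_nonneg less_imp_le order_trans zero_le_power2)
  then have "nonneg_op smul ip R"
    unfolding nonneg_op_def self_adjoint_iff using bounded_opI[OF R(1) smul] sym real by blast
  moreover have "R \<circ> R = C" using R(2) by (simp add: fun_eq_iff)
  moreover have "T = R" if T: "nonneg_op smul ip T" "T \<circ> T = C" for T
  proof (rule rl.coercive_root_unique[OF root])
    show "bounded_linear T"
      using T(1) bounded_op_bounded_linear by (auto simp: nonneg_op_def self_adjoint_def)
    show "T (T x) = C x" for x using T(2) by (simp add: fun_eq_iff)
    show "re (ip (T x) x) \<ge> 0" for x
      using T(1) unfolding nonneg_op_def by (metis re_of_real)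
  qed
  ultimately have "op_sqrt smul ip C = R"
    unfolding op_sqrt_def by (intro the_equality) blast+
  then show ?thesis
    unfolding rl.rip_self[symmetric] using R(3)[of "R x" x] by (simp add: R(2))
qed

section \<open>From controlled frames to frames\<close>

lemma adj_commute_self_adjoint:
  assumes "bounded_op smul K" and "\<And>x y. ip (C x) y = ip x (C y)" and "C \<circ> K = K \<circ> C"
  shows "adj ip K (C x) = C (adj ip K x)"
proof (rule ip_eqI)
  fix y
  have "C (K y) = K (C y)" using assms(3) by (metis comp_apply)
  then show "re (ip y (adj ip K (C x))) = re (ip y (C (adj ip K x)))"
    by (metis assms(2) ip_adj[OF assms(1)])
qed

lemma controlled_K_frame_imp_K_frame:
  assumes K: "bounded_op smul K" and CGL: "C \<in> GL_plus smul ip" and comm: "C \<circ> K = K \<circ> C"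
    and frame: "controlled_K_frame smul ip C K f"
  shows "K_frame ip K f"
proof -
  note C = GL_plus_coercive[OF CGL]
  obtain c where c: "c > 0" "\<And>x. c * (norm x)\<^sup>2 \<le> re (ip (C x) x)" using C(3) by blast
  obtain N where N: "N > 0" "\<And>x. norm (C x) \<le> norm x * N"
    using bounded_linear.pos_bounded[OF bounded_op_bounded_linear[OF C(1)]] by blast
  let ?Q = "\<lambda>x. \<Sum>n. (norm (ip x (f n)))\<^sup>2"
  from frame obtain B where B: "B > 0"
      "\<And>x. summable (\<lambda>n. (norm (ip x (f n)))\<^sup>2)" "\<And>x. ?Q x \<le> B * (norm x)\<^sup>2"
    unfolding controlled_K_frame_def K_Bessel_def by blast
  from frame obtain A s where A: "A > 0"
      "\<And>x. (\<lambda>n. ip x (f n) * ip (C (f n)) x) sums of_real (s x)"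
      "\<And>x. A * (norm (op_sqrt smul ip C (adj ip K x)))\<^sup>2 \<le> s x"
    unfolding controlled_K_frame_def by metis
  let ?T = "adj ip K"
  interpret T: bounded_linear ?T using K by (rule adj_bounded_linear)
  obtain L where L: "L > 0" "\<And>x. norm (?T x) \<le> norm x * L" using T.pos_bounded by blast
  \<comment> \<open>The quadratic form of the operator D, with A taken from the controlled lower
    bound; q \<ge> 0 is the lower frame inequality with this same A.\<close>
  define q where "q x = ?Q x - A * (norm (?T x))\<^sup>2" for x
  have shrink: "(norm (x - h *\<^sub>R C x))\<^sup>2 \<le> (1 - 2 * h * c + h\<^sup>2 * N\<^sup>2) * (norm x)\<^sup>2" if "h \<ge> 0" for h x
    by (rule rl.norm_diff_coercive_sq_le[OF c(2) _ that]) (use N in \<open>simp add: mult.commute\<close>)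
  have lower: "- (A * L\<^sup>2) * (norm x)\<^sup>2 \<le> q x" for x
  proof -
    have "(norm (?T x))\<^sup>2 \<le> (norm x * L)\<^sup>2" using L by (intro power_mono) auto
    then have "A * (norm (?T x))\<^sup>2 \<le> A * (norm x * L)\<^sup>2" using A by simp
    moreover have "0 \<le> ?Q x" by (rule suminf_nonneg[OF B(2)]) simp
    ultimately show ?thesis by (simp add: q_def power_mult_distrib algebra_simps)
  qed
  have growth: "q (x - h *\<^sub>R C x) \<le> q x + h\<^sup>2 * (B * N\<^sup>2) * (norm x)\<^sup>2" if "h \<ge> 0" for h x
  proof -
    \<comment> \<open>Self-adjointness of C identifies the controlled series with the cross term in
      the expansion of \<open>?Q (x - h *\<^sub>R C x)\<close>.\<close>
    have "ip (C (f n)) x = conj (ip (C x) (f n))" for n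
      by (metis C(2) ip_commute)
    then have "(\<lambda>n. re (ip x (f n) * conj (ip (C x) (f n)))) sums s x"
      using bounded_linear.sums[OF bounded_linear_re A(2)[of x]] by simp
    then have "(\<lambda>n. (norm (ip x (f n)))\<^sup>2 - 2 * h * re (ip x (f n) * conj (ip (C x) (f n)))
          + h\<^sup>2 * (norm (ip (C x) (f n)))\<^sup>2) sums (?Q x - 2 * h * s x + h\<^sup>2 * ?Q (C x))"
      by (intro sums_add sums_diff sums_mult summable_sums B(2))
    then have "(\<lambda>n. (norm (ip (x - h *\<^sub>R C x) (f n)))\<^sup>2) sums (?Q x - 2 * h * s x + h\<^sup>2 * ?Q (C x))"
      by (simp add: ip_diff_left ip_scaleR_left norm_diff_of_real_mult_sq)
    then have 1: "?Q (x - h *\<^sub>R C x) = ?Q x - 2 * h * s x + h\<^sup>2 * ?Q (C x)"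
      by (rule sums_unique[symmetric])
    have "?T (x - h *\<^sub>R C x) = ?T x - h *\<^sub>R C (?T x)"
      using adj_commute_self_adjoint[OF K C(2) comm] by (simp add: T.diff T.scaleR)
    then have 2: "(norm (?T (x - h *\<^sub>R C x)))\<^sup>2
        = (norm (?T x))\<^sup>2 - 2 * h * re (ip (C (?T x)) (?T x)) + h\<^sup>2 * (norm (C (?T x)))\<^sup>2"
      by (simp add: rl.norm_diff_scaleR_sq C(2))
    \<comment> \<open>The controlled lower bound says that the first-order change of q along the
      step is at most 0.\<close>
    have 3: "h * (A * re (ip (C (?T x)) (?T x))) \<le> h * s x"
      using A(3)[of x] that by (intro mult_left_mono) (simp_all add: norm_op_sqrt_sq[OF CGL])
    have "?Q (C x) \<le> B * (norm (C x))\<^sup>2" by (rule B(3))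
    also have "\<dots> \<le> B * (norm x * N)\<^sup>2" using B(1) N by (intro mult_left_mono power_mono) auto
    finally have 4: "h\<^sup>2 * ?Q (C x) \<le> h\<^sup>2 * (B * (norm x * N)\<^sup>2)" by (intro mult_left_mono) auto
    have 5: "0 \<le> A * (h\<^sup>2 * (norm (C (?T x)))\<^sup>2)" using A(1) by simp
    show ?thesis
      using 3 4 5 unfolding q_def 1 2 by (simp add: power_mult_distrib algebra_simps)
  qed
  have "q x \<ge> 0" for x
    by (rule form_nonneg_by_descent[OF c(1) shrink growth lower]) (use A(1) B(1) in simp_all)
  then have "A * (norm (?T x))\<^sup>2 \<le> ?Q x" for x by (simp add: q_def)
  then show ?thesis unfolding K_frame_def using A(1) B by blast
qed

end

theorem proposition2p7:
  fixes smul :: "'k::rclike \<Rightarrow> 'h::banach \<Rightarrow> 'h"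
    and ip :: "'h \<Rightarrow> 'h \<Rightarrow> 'k"
    and K C :: "'h \<Rightarrow> 'h"
    and f :: "nat \<Rightarrow> 'h"
  assumes "hilbert_space smul ip"
    and "separable_space (euclidean :: 'h topology)"
    and "bounded_op smul K"
    and "closed (range K)"
    and "C \<in> GL_plus smul ip"
    and "C \<circ> K = K \<circ> C"
    and "controlled_K_frame smul ip C K f"
  shows "K_frame ip K f"
  by (rule hilbert_space.controlled_K_frame_imp_K_frame[OF assms(1,3,5,6,7)])

end
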